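(* Let $p$ be a prime and let $\mathcal{A}$ be a non-empty subset of $\mathbb{Z}/p\mathbb{Z}$. Let $t$ be an integer with $t\notin\{0,1,-1\}$ such that $|t|$ is a prime power or a product of two primes. Let $w(t)$ be a constant (depending only on $t$) such that every non-empty finite set of integers $\mathcal{B}\subset\mathbb{Z}$ satisfies $|\mathcal{B}+t\cdot\mathcal{B}|\geq (|t|+1)|\mathcal{B}|-w(t)$. Then $$|\mathcal{A}+t\cdot\mathcal{A}|\geq \min\left(f_{|t|}(c)\,|\mathcal{A}|-w(t),\ p\right),$$ where $c=|\mathcal{A}|/p$.
   Context: For a set $\mathcal{U}$ (of integers or of residues mod $p$) and an integer $t$, $t\cdot\mathcal{U}=\{tu: u\in\mathcal{U}\}$ (computed mod $p$ in $\mathbb{Z}/p\mathbb{Z}$), and $\mathcal{U}+\mathcal{V}=\{u+v:u\in\mathcal{U},v\in\mathcal{V}\}$. The functions $f_s$ ($s\geq 2$ an integer) on $[0,1]$ are defined as follows. For $s=2$: let $c_2^{(0)}=\frac{1-2^{3/2}/3}{2}$; for $0\le c\le c_2^{(0)}$, $f_2(c)$ is the unique solution $x\geq 2$ of $3(1-cx)=x^{3/2}$, and $f_2(c)=2$ otherwise. For $s\geq 3$: let $c_s^{(0)}=\frac12\left(1-\frac{2^{3/2}}{(s+1)\sin\left(\frac{\pi}{s+1}\right)}\right)$; for $0\le c\le c_s^{(0)}$, $f_s(c)$ is the unique solution $x\geq 2$ of $(s+1)\sin\left(\frac{\pi}{s+1}\right)(1-cx)=x^{3/2}\sin\left(\frac{\pi}{x}\right)$,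 and $f_s(c)=2$ otherwise. (Such a constant $w(t)$ exists by known results for $|t|$ a prime power or product of two primes.) *)

theory Defs
  imports Complex_Main "HOL-Number_Theory.Number_Theory" "HOL-Number_Theory.Prime_Powers"
    "HOL-Library.Set_Algebras"
begin

definition dilate_mod :: "nat \<Rightarrow> int \<Rightarrow> int set \<Rightarrow> int set" where
  "dilate_mod p t U = (\<lambda>u. u mod int p) ` (t *o U)"

definition dilate_c0 :: "nat \<Rightarrow> real" where
  "dilate_c0 s =
     (if s = 2 then (1 - 2 powr (3/2) / 3) / 2
      else (1/2) * (1 - 2 powr (3/2) / ((real s + 1) * sin (pi / (real s + 1)))))"

(* Only s \<ge> 2 and c in [0,1] are meaningful; there the defining equation has exactly one solution
   x \<ge> 2 whenever c \<le> dilate_c0 s, because its left side is non-increasing in x,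
   its right side strictly increasing and unbounded, and c \<le> dilate_c0 s says that the right side
   does not exceed the left one at x = 2. *)
definition dilate_f :: "nat \<Rightarrow> real \<Rightarrow> real" where
  "dilate_f s c =
     (if 0 \<le> c \<and> c \<le> dilate_c0 s then
        (if s = 2 then (THE x. x \<ge> 2 \<and> 3 * (1 - c * x) = x powr (3/2))
         else (THE x. x \<ge> 2 \<and>
                 (real s + 1) * sin (pi / (real s + 1)) * (1 - c * x) = x powr (3/2) * sin (pi / x)))
      else 2)"

end

theory Submission
  imports Defs "HOL-Analysis.Analysis"
begin

text \<open>
  If \<open>p\<close> divides \<open>t\<close> or \<open>f = 2\<close>, the bound follows from \<open>w(t) \<ge> |t|\<close> (take \<open>B = {0}\<close>) and from the
  Cauchy-Davenport theorem. Otherwise put \<open>s = |t|\<close>, \<open>S = A + t A\<close> and suppose \<open>|S| < f |A| - w(t)\<close>.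
  If a dilate of \<open>A\<close> had at least \<open>n = f |A| / (s + 1)\<close> points \<open>B\<close> in an interval shorter than
  \<open>p / (s + 1)\<close>, then \<open>B + t B\<close> would live in an interval shorter than \<open>p\<close>, and the integer bound would
  give \<open>|S| \<ge> (s + 1) n - w(t)\<close>. So for every non-trivial additive character the values on \<open>A\<close> are spread
  out: each open arc of length \<open>2 pi / (s + 1)\<close> contains at most \<open>n\<close> of them, which bounds the Fourier
  coefficients of \<open>A\<close> by \<open>n sin(pi / f) / sin(pi / (s + 1))\<close>, or by \<open>n\<close> when \<open>s = 2\<close>. Counting the solutions
  of \<open>a + t b = x\<close> with \<open>x\<close> in \<open>S\<close> by characters and using Cauchy-Schwarz and Parseval contradicts the
  equation that defines \<open>f\<close>.
\<close>

section \<open>The Cauchy-Davenport theorem\<close>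

text \<open>As \<open>m\<close> is prime, \<open>d\<close> is invertible modulo \<open>m\<close>, so
  repeated shifts by \<open>d\<close> lead from any residue to every other one.\<close>

lemma shift_closed_eq_full:
  fixes m d :: int
  assumes "prime m" "A \<subseteq> {0..<m}" "A \<noteq> {}" "\<not> m dvd d" and closed: "\<And>a. a \<in> A \<Longrightarrow> (a + d) mod m \<in> A"
  shows "A = {0..<m}"
proof
  show "{0..<m} \<subseteq> A"
  proof
    fix y assume y: "y \<in> {0..<m}"
    obtain a where a: "a \<in> A" using assms by blast
    have step: "(a + int k * d) mod m \<in> A" for k
    proof (induction k)
      case 0 then show ?case using a assms(2) by auto
    next
      case (Suc k)
      have "((a + int k * d) mod m + d) mod m = (a + int (Suc k) * d) mod m"
        by (simp add: mod_simps algebra_simps)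
      then show ?case using closed[OF Suc] by simp
    qed
    have "coprime d m" using assms prime_imp_coprime coprime_commute by blast
    then obtain x where x: "[d * x = 1] (mod m)" using cong_solve_coprime_int by blast
    \<comment> \<open>Here \<open>x\<close> inverts \<open>d\<close>, so \<open>x * (y - a)\<close>
      shifts by \<open>d\<close> carry \<open>a\<close> to \<open>y\<close>; reducing modulo
      \<open>m\<close> makes that number a natural one, as \<open>step\<close> needs.\<close>
    define k where "k = nat ((x * (y - a)) mod m)"
    have m: "m > 0" using assms(1) prime_gt_0_int by blast
    have "[int k = x * (y - a)] (mod m)" using m by (simp add: k_def cong_def)
    then have "[a + int k * d = a + (x * (y - a)) * d] (mod m)"
      by (intro cong_add cong_mult cong_refl)
    also have "a + (x * (y - a)) * d = a + (d * x) * (y - a)" by simp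
    also have "[a + (d * x) * (y - a) = a + 1 * (y - a)] (mod m)"
      by (intro cong_add cong_mult cong_refl x)
    finally have "(a + int k * d) mod m = y mod m" unfolding Cong.cong_def by simp
    then have "(a + int k * d) mod m = y" using y by simp
    then show "y \<in> A" using step[of k] by simp
  qed
qed (use assms in auto)

text \<open>Strong induction on \<open>card B\<close> with \<open>A\<close> varying: the transform
  keeps \<open>card A + card B\<close>, does not enlarge the sumset and leaves a smaller non-empty
  second set. A singleton \<open>B\<close> or a full \<open>A\<close> ends the descent.\<close>

theorem cauchy_davenport_mod:
  fixes m :: int
  assumes "prime m" "A \<subseteq> {0..<m}" "B \<subseteq> {0..<m}" "A \<noteq> {}" "B \<noteq> {}"
  shows "min m (int (card A) + int (card B) - 1) \<le> int (card ((\<lambda>(a, b). (a + b) mod m) ` (A \<times> B)))"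
  using assms(2-)
proof (induction "card B" arbitrary: A B rule: less_induct)
  case less
  let ?S = "\<lambda>A B. (\<lambda>(a, b). (a + b) mod m) ` (A \<times> B)"
  have m: "m > 0" using assms(1) prime_gt_0_int by blast
  have fin: "finite A" "finite B" using less.prems finite_subset by blast+
  have inj: "inj_on (\<lambda>x. (x + d) mod m) X" if "X \<subseteq> {0..<m}" for d X
  proof (rule inj_onI)
    fix x y assume xy: "x \<in> X" "y \<in> X" "(x + d) mod m = (y + d) mod m"
    then have "x mod m = y mod m" by (metis add_diff_cancel_right' mod_diff_left_eq)
    then show "x = y" using xy that by (metis atLeastLessThan_iff mod_pos_pos_trivial subsetD)
  qed
  obtain b1 where b1: "b1 \<in> B" using less.prems by blast
  have "(\<lambda>a. (a + b1) mod m) ` A \<subseteq> ?S A B" using b1 by force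
  then have ge: "card A \<le> card (?S A B)"
    using card_image[OF inj[OF less.prems(1)]] fin by (metis card_mono finite_SigmaI finite_imageI)
  consider "B = {b1}" | "A = {0..<m}" | b2 where "b2 \<in> B" "b2 \<noteq> b1" "A \<noteq> {0..<m}"
    using b1 by blast
  then show ?case
  proof cases
    case 1
    then show ?thesis using ge by simp
  next
    case 2
    then show ?thesis using ge m by simp
  next
    case 3
    have "\<not> m dvd b2 - b1"
      using 3 b1 less.prems(2)
      by (metis atLeastLessThan_iff mod_eq_dvd_iff mod_pos_pos_trivial subsetD)
    \<comment> \<open>A proper subset is not closed under the shift by \<open>b2 - b1\<close>. For
      the resulting \<open>a\<close>, the shift \<open>e = a - b1\<close> sends \<open>b1\<close>
      into \<open>A\<close> and \<open>b2\<close> outside, so \<open>B'\<close> is non-empty and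
      proper.\<close>
    then obtain a where a: "a \<in> A" "(a + (b2 - b1)) mod m \<notin> A"
      using shift_closed_eq_full[OF assms(1) less.prems(1,3)] 3 by blast
    \<comment> \<open>Davenport's transform: move the part of \<open>B + e\<close> outside \<open>A\<close> from \<open>B\<close> to \<open>A\<close>.\<close>
    define e where "e = a - b1"
    define T where "T = (\<lambda>b. (b + e) mod m) ` B - A"
    define B' where "B' = {b \<in> B. (b + e) mod m \<in> A}"
    have "T = (\<lambda>b. (b + e) mod m) ` (B - B')" by (auto simp: T_def B'_def)
    then have "card T = card (B - B')" using inj less.prems(2) by (metis Diff_subset card_image dual_order.trans)
    also have "\<dots> = card B - card B'" using fin by (intro card_Diff_subset) (auto simp: B'_def)
    finally have cT: "card T = card B - card B'" .
    have "b2 \<notin> B'" using a by (simp add: B'_def e_def algebra_simps)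
    then have "B' \<subset> B" using 3 by (auto simp: B'_def)
    then have cB: "card B' < card B" using fin psubset_card_mono by blast
    have "b1 \<in> B'" using a b1 less.prems(1) by (auto simp: B'_def e_def)
    have cA: "card (A \<union> T) = card A + card T"
      using fin by (intro card_Un_disjoint) (auto simp: T_def)
    have sub: "?S (A \<union> T) B' \<subseteq> ?S A B"
    proof
      fix z assume "z \<in> ?S (A \<union> T) B'"
      then obtain x b where z: "z = (x + b) mod m" "x \<in> A \<union> T" "b \<in> B'" by auto
      show "z \<in> ?S A B"
      proof (cases "x \<in> A")
        case True
        then show ?thesis using z by (force simp: B'_def)
      next
        case False
        then obtain b0 where b0: "b0 \<in> B" "x = (b0 + e) mod m" using z by (auto simp: T_def)
        \<comment> \<open>The shift \<open>e\<close> moves from \<open>b0\<close> to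
          \<open>b\<close>: \<open>b + e\<close> falls into \<open>A\<close> because
          \<open>b\<close> is in \<open>B'\<close>, and \<open>b0\<close> stays in
          \<open>B\<close>.\<close>
        have "z = ((b + e) mod m + b0) mod m" using z b0 by (simp add: mod_simps algebra_simps)
        moreover have "((b + e) mod m, b0) \<in> A \<times> B" using z b0 by (simp add: B'_def)
        ultimately show ?thesis by (metis (mono_tags, lifting) case_prod_conv imageI)
      qed
    qed
    have "min m (int (card (A \<union> T)) + int (card B') - 1) \<le> int (card (?S (A \<union> T) B'))"
      using cB \<open>b1 \<in> B'\<close> less.prems m by (intro less.hyps) (auto simp: T_def B'_def)
    also have "\<dots> \<le> int (card (?S A B))" using sub fin by (simp add: card_mono)
    finally show ?thesis using cA cT cB by simp
  qed
qed

section \<open>Unit vectors with few points on each arc\<close>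

text \<open>Weak duality for the linear program that maximises the sum of cosines: \<open>\<nu>\<close> prices the arc
  constraints and \<open>l\<close> prices the total number of points. Angles are not identified modulo \<open>2 pi\<close>;
  this only weakens the hypothesis on the count.\<close>

lemma sum_cos_le_dual:
  fixes \<theta> :: "'a \<Rightarrow> real" and \<nu> :: "real \<Rightarrow> real" and h l n :: real
  assumes "finite A" and \<theta>: "\<And>x. x \<in> A \<Longrightarrow> \<bar>\<theta> x\<bar> \<le> pi"
    and h: "0 < h" "h \<le> pi"
    and count: "\<And>\<alpha>. real (card {x \<in> A. \<bar>\<theta> x - \<alpha>\<bar> < h}) \<le> n"
    and int: "\<nu> integrable_on {-2*pi..2*pi}" and nonneg: "\<And>\<alpha>. 0 \<le> \<nu> \<alpha>"
    and dual: "\<And>u. \<bar>u\<bar> \<le> pi \<Longrightarrow> cos u \<le> l + integral {u-h..u+h} \<nu>"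
  shows "(\<Sum>x\<in>A. cos (\<theta> x)) \<le> l * card A + n * integral {-2*pi..2*pi} \<nu>"
proof -
  \<comment> \<open>Wide enough for every window of radius \<open>h \<le> pi\<close> around an angle
    in \<open>[-pi, pi]\<close>.\<close>
  let ?R = "{-2*pi..2*pi}"
  let ?g = "\<lambda>x \<alpha>. if \<alpha> \<in> {\<theta> x - h<..<\<theta> x + h} then \<nu> \<alpha> else 0"
  have g: "(?g x has_integral integral {\<theta> x - h..\<theta> x + h} \<nu>) ?R" if "x \<in> A" for x
  proof -
    have sub: "{\<theta> x - h..\<theta> x + h} \<subseteq> ?R" using \<theta>[OF that] h by auto
    then have "\<nu> integrable_on {\<theta> x - h..\<theta> x + h}" using int integrable_on_subinterval by blast
    then have "(\<nu> has_integral integral {\<theta> x - h..\<theta> x + h} \<nu>) (cbox (\<theta> x - h) (\<theta> x + h))"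
      by (simp add: integrable_integral)
    then have "(\<nu> has_integral integral {\<theta> x - h..\<theta> x + h} \<nu>) (box (\<theta> x - h) (\<theta> x + h))"
      by (simp only: has_integral_open_interval)
    then have "(\<nu> has_integral integral {\<theta> x - h..\<theta> x + h} \<nu>) {\<theta> x - h<..<\<theta> x + h}"
      by simp
    moreover have "{\<theta> x - h<..<\<theta> x + h} \<subseteq> ?R" using sub by force
    ultimately show ?thesis by (simp only: has_integral_restrict)
  qed
  have "(\<Sum>x\<in>A. cos (\<theta> x)) \<le> (\<Sum>x\<in>A. l + integral {\<theta> x - h..\<theta> x + h} \<nu>)"
    using \<theta> dual by (intro sum_mono) auto
  also have "\<dots> = l * card A + (\<Sum>x\<in>A. integral {\<theta> x - h..\<theta> x + h} \<nu>)"
    by (simp add: sum.distrib)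
  also have "(\<Sum>x\<in>A. integral {\<theta> x - h..\<theta> x + h} \<nu>) \<le> n * integral ?R \<nu>"
  proof (rule has_integral_le)
    show "((\<lambda>\<alpha>. \<Sum>x\<in>A. ?g x \<alpha>) has_integral (\<Sum>x\<in>A. integral {\<theta> x - h..\<theta> x + h} \<nu>)) ?R"
      using assms(1) g by (intro has_integral_sum) auto
    show "((\<lambda>\<alpha>. n * \<nu> \<alpha>) has_integral n * integral ?R \<nu>) ?R"
      using int by (intro has_integral_mult_right integrable_integral)
    \<comment> \<open>After the sum and the integral are exchanged, the integrand at
      \<open>\<alpha>\<close> counts the points whose open window contains \<open>\<alpha>\<close>,
      which are those on the arc around \<open>\<alpha>\<close>.\<close>
    fix \<alpha>
    have "(\<Sum>x\<in>A. ?g x \<alpha>) = (\<Sum>x\<in>{x \<in> A. \<bar>\<theta> x - \<alpha>\<bar> < h}. \<nu> \<alpha>)"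
      using assms(1) by (intro sum.mono_neutral_cong_right) (auto simp: abs_less_iff)
    also have "\<dots> \<le> n * \<nu> \<alpha>" using count nonneg by (simp add: mult_right_mono)
    finally show "(\<Sum>x\<in>A. ?g x \<alpha>) \<le> n * \<nu> \<alpha>" .
  qed
  finally show ?thesis by simp
qed

text \<open>The model case is \<open>b = k * h\<close> for an integer \<open>k\<close>: clusters of
  \<open>n\<close> points at \<open>k\<close> angles with spacing \<open>2 * h\<close>, symmetric
  about 0, respect the arc condition and attain the bound. The proof supplies a matching dual
  solution.\<close>

lemma sum_cos_le_sin:
  fixes \<theta> :: "'a \<Rightarrow> real" and h b n :: real
  assumes "finite A" and \<theta>: "\<And>x. x \<in> A \<Longrightarrow> \<bar>\<theta> x\<bar> \<le> pi"
    and h: "0 < h" "h \<le> pi/2" and b: "0 < b" "b \<le> pi/2"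
    and count: "\<And>\<alpha>. real (card {x \<in> A. \<bar>\<theta> x - \<alpha>\<bar> < h}) \<le> n" and n: "n * b = card A * h"
  shows "(\<Sum>x\<in>A. cos (\<theta> x)) \<le> n * sin b / sin h"
proof -
  \<comment> \<open>Without truncation the integral over \<open>{u-h..u+h}\<close> is exactly
    \<open>cos u - h * cos b / sin h\<close>, so the dual constraint is an equality with
    \<open>l = h * cos b / sin h\<close>. Cutting off the negative part can only increase the
    integral.\<close>
  define \<nu> where "\<nu> = (\<lambda>\<alpha>. if \<alpha> \<in> {-b..b} then (cos \<alpha> - cos b) / (2 * sin h) else 0)"
  have sinh: "sin h > 0" using h pi_gt_zero by (intro sin_gt_zero) auto
  have prim: "((\<lambda>\<alpha>. (cos \<alpha> - cos b) / (2 * sin h)) has_integral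
      (sin y - y * cos b) / (2 * sin h) - (sin x - x * cos b) / (2 * sin h)) {x..y}" if "x \<le> y" for x y
    using that sinh by (intro fundamental_theorem_of_calculus)
      (auto intro!: derivative_eq_intros simp: field_simps simp flip: has_real_derivative_iff_has_vector_derivative)
  have \<nu>_int: "(\<nu> has_integral (sin b - b * cos b) / sin h) {-2*pi..2*pi}"
  proof -
    have "((\<lambda>\<alpha>. (cos \<alpha> - cos b) / (2 * sin h)) has_integral (sin b - b * cos b) / sin h) {-b..b}"
    proof -
      have "(sin b - b * cos b) / (2 * sin h) - (sin (-b) - (-b) * cos b) / (2 * sin h) = (sin b - b * cos b) / sin h"
        using sinh by (simp add: field_simps)
      then show ?thesis using prim[of "-b" b] b by simp
    qed
    moreover have "{-b..b} \<subseteq> {-2*pi..2*pi}" using b by auto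
    ultimately show ?thesis unfolding \<nu>_def by (simp only: has_integral_restrict)
  qed
  have nonneg: "0 \<le> \<nu> \<alpha>" for \<alpha>
    using sinh b cos_monotone_0_pi_le[of "\<bar>\<alpha>\<bar>" b] by (auto simp: \<nu>_def abs_le_iff)
  \<comment> \<open>Windows reach up to \<open>pi + h \<le> 3/2 * pi\<close>. Beyond
    \<open>pi\<close> the cosine is compared at \<open>2*pi - \<bar>\<alpha>\<bar>\<close>, which is
    still at least \<open>pi/2 \<ge> b\<close>.\<close>
  have below: "(cos \<alpha> - cos b) / (2 * sin h) \<le> \<nu> \<alpha>" if "\<bar>\<alpha>\<bar> \<le> 3/2 * pi" for \<alpha>
  proof (cases "\<bar>\<alpha>\<bar> \<le> b")
    case False
    have "cos \<alpha> \<le> cos b"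
    proof (cases "\<bar>\<alpha>\<bar> \<le> pi")
      case True
      then show ?thesis using False b cos_monotone_0_pi_le[of b "\<bar>\<alpha>\<bar>"] by simp
    next
      case False
      then have "cos (2*pi - \<bar>\<alpha>\<bar>) \<le> cos b"
        using that b by (intro cos_monotone_0_pi_le) auto
      then show ?thesis by (simp add: cos_diff)
    qed
    then show ?thesis using sinh False by (auto simp: \<nu>_def divide_nonpos_pos)
  qed (auto simp: \<nu>_def)
  have "(\<Sum>x\<in>A. cos (\<theta> x)) \<le> (h * cos b / sin h) * card A + n * integral {-2*pi..2*pi} \<nu>"
  proof (rule sum_cos_le_dual[OF assms(1) \<theta> h(1) _ count _ nonneg])
    show "h \<le> pi" using h by simp
    show "\<nu> integrable_on {-2*pi..2*pi}" using \<nu>_int by blast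
    fix u :: real assume u: "\<bar>u\<bar> \<le> pi"
    have "((\<lambda>\<alpha>. (cos \<alpha> - cos b) / (2 * sin h)) has_integral cos u - h * cos b / sin h) {u-h..u+h}"
    proof -
      have "(sin (u+h) - (u+h) * cos b) / (2 * sin h) - (sin (u-h) - (u-h) * cos b) / (2 * sin h)
          = cos u - h * cos b / sin h"
        using sinh by (simp add: sin_add sin_diff field_simps)
      then show ?thesis using prim[of "u-h" "u+h"] h by simp
    qed
    moreover have "(\<nu> has_integral integral {u-h..u+h} \<nu>) {u-h..u+h}"
    proof -
      have "{u-h..u+h} \<subseteq> {-2*pi..2*pi}" using u h by auto
      then show ?thesis using \<nu>_int integrable_on_subinterval integrable_integral by blast
    qed
    ultimately have "cos u - h * cos b / sin h \<le> integral {u-h..u+h} \<nu>"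
      by (rule has_integral_le) (use u h below in auto)
    then show "cos u \<le> h * cos b / sin h + integral {u-h..u+h} \<nu>" by simp
  qed
  also have "integral {-2*pi..2*pi} \<nu> = (sin b - b * cos b) / sin h" using \<nu>_int by blast
  \<comment> \<open>The two terms in \<open>cos b\<close> cancel because
    \<open>n * b = card A * h\<close>; this relation is what fixes the cut-off
    \<open>b\<close>.\<close>
  also have "(h * cos b / sin h) * card A + n * ((sin b - b * cos b) / sin h)
      = (n * sin b + cos b * (card A * h - n * b)) / sin h" using sinh by (simp add: field_simps)
  finally show ?thesis using n by simp
qed

text \<open>For arcs of length \<open>2 pi / 3\<close> the weight \<open>sin (pi/3 - |\<alpha>|)\<close> does better than the truncated cosine
  above, and no price on the total number of points is needed.\<close>

lemma sum_cos_le_count: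
  fixes \<theta> :: "'a \<Rightarrow> real" and n :: real
  assumes "finite A" and \<theta>: "\<And>x. x \<in> A \<Longrightarrow> \<bar>\<theta> x\<bar> \<le> pi"
    and count: "\<And>\<alpha>. real (card {x \<in> A. \<bar>\<theta> x - \<alpha>\<bar> < pi/3}) \<le> n"
  shows "(\<Sum>x\<in>A. cos (\<theta> x)) \<le> n"
proof -
  define \<nu> where "\<nu> = (\<lambda>\<alpha>. if \<alpha> \<in> {-pi/3..pi/3} then sin (pi/3 - \<bar>\<alpha>\<bar>) else 0)"
  have nonneg: "0 \<le> \<nu> \<alpha>" for \<alpha>
    by (auto simp: \<nu>_def intro!: sin_ge_zero)
  have half: "(\<nu> has_integral 1/2) {-pi/3..0}" "(\<nu> has_integral 1/2) {0..pi/3}"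
  proof -
    have "((\<lambda>\<alpha>. sin (pi/3 + \<alpha>)) has_integral (- cos (pi/3 + 0)) - (- cos (pi/3 + -pi/3))) {-pi/3..0}"
      by (intro fundamental_theorem_of_calculus)
        (auto intro!: derivative_eq_intros simp flip: has_real_derivative_iff_has_vector_derivative)
    then have "((\<lambda>\<alpha>. sin (pi/3 + \<alpha>)) has_integral 1/2) {-pi/3..0}" by (simp add: cos_60)
    then show "(\<nu> has_integral 1/2) {-pi/3..0}"
      by (rule has_integral_eq[rotated]) (auto simp: \<nu>_def)
    have "((\<lambda>\<alpha>. sin (pi/3 - \<alpha>)) has_integral cos (pi/3 - pi/3) - cos (pi/3 - 0)) {0..pi/3}"
      by (intro fundamental_theorem_of_calculus)
        (auto intro!: derivative_eq_intros simp flip: has_real_derivative_iff_has_vector_derivative)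
    then have "((\<lambda>\<alpha>. sin (pi/3 - \<alpha>)) has_integral 1/2) {0..pi/3}" by (simp add: cos_60)
    then show "(\<nu> has_integral 1/2) {0..pi/3}"
      by (rule has_integral_eq[rotated]) (auto simp: \<nu>_def)
  qed
  have whole: "(\<nu> has_integral 1) {-pi/3..pi/3}"
    using has_integral_combine[OF _ _ half] by simp
  have \<nu>_int: "(\<nu> has_integral 1) {-2*pi..2*pi}"
    using whole by (rule has_integral_on_superset) (auto simp: \<nu>_def)
  then have sub_int: "\<nu> integrable_on {x..y}" if "{x..y} \<subseteq> {-2*pi..2*pi}" for x y
    using that integrable_on_subinterval by blast
  have even: "\<nu> (-\<alpha>) = \<nu> \<alpha>" for \<alpha> by (auto simp: \<nu>_def)
  have pos: "cos u \<le> integral {u - pi/3..u + pi/3} \<nu>" if u: "0 \<le> u" "u \<le> pi" for u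
  proof (cases "u \<le> pi/2")
    case False
    then have "cos u \<le> 0" using u cos_monotone_0_pi_le[of "pi/2" u] by simp
    also have "0 \<le> integral {u - pi/3..u + pi/3} \<nu>"
      by (rule integral_nonneg[OF sub_int]) (use u nonneg in auto)
    finally show ?thesis .
  next
    case True
    \<comment> \<open>The window misses only the tail to the left of \<open>u - pi/3\<close>. The
      total mass is 1, so it suffices that this tail has mass at most
      \<open>1 - cos u\<close>.\<close>
    have "((\<lambda>\<alpha>. sin (pi/3 + \<alpha>)) has_integral (- cos (pi/3 + (u - pi/3))) - (- cos (pi/3 + -pi/3))) {-pi/3..u-pi/3}"
      using u by (intro fundamental_theorem_of_calculus)
        (auto intro!: derivative_eq_intros simp flip: has_real_derivative_iff_has_vector_derivative)
    then have upper: "((\<lambda>\<alpha>. sin (pi/3 + \<alpha>)) has_integral 1 - cos u) {-pi/3..u-pi/3}" by simp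
    have "integral {-pi/3..u-pi/3} \<nu> \<le> 1 - cos u"
    proof (rule has_integral_le[OF _ upper])
      show "(\<nu> has_integral integral {-pi/3..u-pi/3} \<nu>) {-pi/3..u-pi/3}"
        using u by (intro integrable_integral sub_int) auto
      fix \<alpha> assume \<alpha>: "\<alpha> \<in> {-pi/3..u-pi/3}"
      \<comment> \<open>For positive \<open>\<alpha>\<close> the bound \<open>u \<le> pi/2\<close>
        gives \<open>pi/3 + \<alpha> \<le> pi/2\<close>, where the sine still increases.\<close>
      show "\<nu> \<alpha> \<le> sin (pi/3 + \<alpha>)"
        using \<alpha> True by (auto simp: \<nu>_def abs_if intro!: sin_monotone_2pi_le)
    qed
    moreover have "integral {-pi/3..u-pi/3} \<nu> + integral {u-pi/3..u+pi/3} \<nu> = integral {-pi/3..u+pi/3} \<nu>"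
      using u by (intro Henstock_Kurzweil_Integration.integral_combine sub_int) auto
    moreover have "(\<nu> has_integral 1) {-pi/3..u+pi/3}"
      using whole by (rule has_integral_on_superset) (use u in \<open>auto simp: \<nu>_def\<close>)
    then have "integral {-pi/3..u+pi/3} \<nu> = 1" by blast
    ultimately show ?thesis by simp
  qed
  have "(\<Sum>x\<in>A. cos (\<theta> x)) \<le> 0 * real (card A) + n * integral {-2*pi..2*pi} \<nu>"
  proof (rule sum_cos_le_dual[OF assms(1) \<theta> _ _ count _ nonneg])
    show "\<nu> integrable_on {-2*pi..2*pi}" using \<nu>_int by blast
    fix u :: real assume u: "\<bar>u\<bar> \<le> pi"
    show "cos u \<le> 0 + integral {u - pi/3..u + pi/3} \<nu>"
    proof (cases "u \<ge> 0")
      case True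
      then show ?thesis using pos[of u] u by simp
    next
      case False
      then have "cos (-u) \<le> integral {-u - pi/3..-u + pi/3} \<nu>" using pos[of "-u"] u by simp
      also have "{-u - pi/3..-u + pi/3} = {-(u + pi/3)..-(u - pi/3)}" by auto
      also have "integral \<dots> \<nu> = integral {u - pi/3..u + pi/3} \<nu>"
        using Henstock_Kurzweil_Integration.integral_reflect_real[of "u + pi/3" "u - pi/3" \<nu>] unfolding even .
      finally show ?thesis by simp
    qed
  qed auto
  also have "integral {-2*pi..2*pi} \<nu> = 1" using \<nu>_int by blast
  finally show ?thesis by simp
qed

text \<open>Rotating by the argument \<open>\<psi>\<close> of the sum makes it real and
  non-negative. The multiples \<open>m x\<close> that bring the angles into \<open>[-pi, pi]\<close>
  are kept explicit because they later choose integer representatives of residues.\<close>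

lemma norm_sum_cis_eq_sum_cos:
  fixes \<eta> :: "'a \<Rightarrow> real"
  shows "\<exists>\<psi> (m :: 'a \<Rightarrow> int).
    norm (\<Sum>x\<in>A. cis (\<eta> x)) = (\<Sum>x\<in>A. cos (\<eta> x - \<psi> + 2 * pi * m x)) \<and>
    (\<forall>x. \<bar>\<eta> x - \<psi> + 2 * pi * m x\<bar> \<le> pi)"
proof -
  define z where "z = (\<Sum>x\<in>A. cis (\<eta> x))"
  define \<psi> where "\<psi> = Arg z"
  define m where "m = (\<lambda>x. - round ((\<eta> x - \<psi>) / (2 * pi)))"
  have 1: "\<bar>\<eta> x - \<psi> + 2 * pi * m x\<bar> \<le> pi" for x
  proof -
    have "\<bar>of_int (round ((\<eta> x - \<psi>) / (2 * pi))) - (\<eta> x - \<psi>) / (2 * pi)\<bar> \<le> 1/2"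
      by (rule of_int_round_abs_le)
    then have "2 * pi * \<bar>of_int (round ((\<eta> x - \<psi>) / (2 * pi))) - (\<eta> x - \<psi>) / (2 * pi)\<bar> \<le> 2 * pi * (1/2)"
      by (intro mult_left_mono) auto
    also have "2 * pi * \<bar>of_int (round ((\<eta> x - \<psi>) / (2 * pi))) - (\<eta> x - \<psi>) / (2 * pi)\<bar>
        = \<bar>2 * pi * (of_int (round ((\<eta> x - \<psi>) / (2 * pi))) - (\<eta> x - \<psi>) / (2 * pi))\<bar>"
      by (simp only: abs_mult) simp
    also have "2 * pi * (of_int (round ((\<eta> x - \<psi>) / (2 * pi))) - (\<eta> x - \<psi>) / (2 * pi))
        = - (\<eta> x - \<psi> + 2 * pi * m x)" by (simp add: m_def field_simps)
    finally show ?thesis by simp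
  qed
  have "z = norm z * cis \<psi>" unfolding \<psi>_def
    by (metis rcis_cmod_Arg rcis_def)
  then have "cis (-\<psi>) * z = norm z"
    by (metis (no_types, lifting) cis_mult mult.assoc mult.commute mult.right_neutral cis_zero add.right_inverse)
  then have "norm z = Re (cis (-\<psi>) * z)" by simp
  also have "\<dots> = (\<Sum>x\<in>A. cos (\<eta> x - \<psi>))"
    by (simp add: z_def sum_distrib_left cis_mult)
  also have "\<dots> = (\<Sum>x\<in>A. cos (\<eta> x - \<psi> + 2 * pi * m x))"
    by (simp add: cos_add)
  finally show ?thesis using 1 unfolding z_def by blast
qed

section \<open>Character sums modulo a prime\<close>

definition add_char :: "nat \<Rightarrow> int \<Rightarrow> complex" where
  "add_char p k = cis (2 * pi * real_of_int k / real p)"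

lemma add_char_0 [simp]: "add_char p 0 = 1"
  and norm_add_char [simp]: "norm (add_char p k) = 1"
  and cnj_add_char: "cnj (add_char p k) = add_char p (- k)"
  and add_char_add: "add_char p (k + l) = add_char p k * add_char p l"
  by (simp_all add: add_char_def cis_cnj cis_mult ring_distribs add_divide_distrib)

lemma add_char_mult_nat: "add_char p (int r * k) = add_char p k ^ r"
  unfolding add_char_def Complex.DeMoivre by (rule arg_cong[of _ _ cis]) simp

lemma add_char_eq_1_iff:
  assumes "p > 0"
  shows "add_char p k = 1 \<longleftrightarrow> int p dvd k"
proof
  assume "add_char p k = 1"
  then have "cos (2 * pi * k / p) = 1" by (simp add: add_char_def complex_eq_iff)
  then obtain n :: int where "2 * pi * k / p = n * 2 * pi" by (auto simp: cos_one_2pi_int)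
  then have "real_of_int k = real_of_int (n * int p)" using assms by (simp add: field_simps)
  then have "k = n * int p" by linarith
  then show "int p dvd k" by simp
next
  assume "int p dvd k"
  then obtain n where "k = int p * n" by blast
  then show "add_char p k = 1"
    using assms cis_multiple_2pi[of "real_of_int n"] by (simp add: add_char_def mult.assoc)
qed

lemma sum_add_char:
  assumes "p > 0"
  shows "(\<Sum>r<p. add_char p (int r * k)) = (if int p dvd k then of_nat p else 0)"
proof (cases "int p dvd k")
  case True
  then have "add_char p k = 1" using add_char_eq_1_iff[OF assms] by blast
  then show ?thesis using True by (simp add: add_char_mult_nat)
next
  case False
  have "add_char p k ^ p = 1"
    using add_char_eq_1_iff[OF assms] by (simp flip: add_char_mult_nat)
  then show ?thesis
    using False add_char_eq_1_iff[OF assms] by (simp add: add_char_mult_nat sum_gp_strict)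
qed

definition char_sum :: "nat \<Rightarrow> int set \<Rightarrow> nat \<Rightarrow> complex" where
  "char_sum p A r = (\<Sum>a\<in>A. add_char p (int r * a))"

lemma parseval_char_sum:
  assumes "p > 0" and A: "A \<subseteq> {0..<int p}"
  shows "(\<Sum>r<p. (norm (char_sum p A r))\<^sup>2) = real p * real (card A)"
proof -
  have fin: "finite A" using A finite_subset by blast
  have "complex_of_real (\<Sum>r<p. (norm (char_sum p A r))\<^sup>2)
      = (\<Sum>r<p. \<Sum>a\<in>A. \<Sum>b\<in>A. add_char p (int r * (a - b)))"
    unfolding of_real_sum complex_norm_square
    by (simp add: char_sum_def cnj_add_char sum_product right_diff_distrib flip: add_char_add)
  also have "\<dots> = (\<Sum>a\<in>A. \<Sum>b\<in>A. \<Sum>r<p. add_char p (int r * (a - b)))"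
    by (subst sum.swap, intro sum.cong refl, subst sum.swap) simp
  also have "\<dots> = (\<Sum>a\<in>A. \<Sum>b\<in>A. if a = b then of_nat p else 0)"
  proof (intro sum.cong refl)
    fix a b assume "a \<in> A" "b \<in> A"
    then have "a mod int p = a" "b mod int p = b" using A by auto
    then have "int p dvd a - b \<longleftrightarrow> a = b" by (metis mod_eq_dvd_iff)
    then show "(\<Sum>r<p. add_char p (int r * (a - b))) = (if a = b then of_nat p else 0)"
      using sum_add_char[OF assms(1)] by simp
  qed
  also have "\<dots> = of_real (real p * real (card A))" using fin by simp
  finally show ?thesis using of_real_eq_iff by blast
qed

text \<open>By orthogonality the left side is \<open>p\<close> times the number of solutions of
  \<open>a + b = s\<close> modulo \<open>p\<close> with \<open>s\<close> in \<open>S\<close>; as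
  \<open>S\<close> is the whole sumset, each pair has exactly one.\<close>

lemma sumset_char_sum:
  fixes A B :: "int set" and p :: nat
  defines "S \<equiv> (\<lambda>(a, b). (a + b) mod int p) ` (A \<times> B)"
  assumes "p > 0" and fin: "finite A" "finite B"
  shows "(\<Sum>r<p. char_sum p A r * char_sum p B r * cnj (char_sum p S r))
           = of_nat (p * card A * card B)"
proof -
  have S: "S \<subseteq> {0..<int p}" "finite S" using assms by (auto simp: S_def)
  have "(\<Sum>r<p. char_sum p A r * char_sum p B r * cnj (char_sum p S r))
      = (\<Sum>r<p. \<Sum>a\<in>A. \<Sum>b\<in>B. \<Sum>s\<in>S. add_char p (int r * (a + b - s)))"
  proof (intro sum.cong refl)
    fix r
    have "char_sum p A r * char_sum p B r * cnj (char_sum p S r)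
        = (\<Sum>a\<in>A. \<Sum>b\<in>B. add_char p (int r * a) * add_char p (int r * b)) * (\<Sum>s\<in>S. add_char p (- (int r * s)))"
      by (simp add: char_sum_def cnj_add_char sum_product)
    also have "\<dots> = (\<Sum>a\<in>A. \<Sum>b\<in>B. \<Sum>s\<in>S. add_char p (int r * a) * add_char p (int r * b) * add_char p (- (int r * s)))"
      unfolding sum_distrib_right by (simp only: sum_distrib_left)
    finally show "char_sum p A r * char_sum p B r * cnj (char_sum p S r)
        = (\<Sum>a\<in>A. \<Sum>b\<in>B. \<Sum>s\<in>S. add_char p (int r * (a + b - s)))"
      by (simp add: distrib_left right_diff_distrib flip: add_char_add)
  qed
  also have "\<dots> = (\<Sum>a\<in>A. \<Sum>b\<in>B. \<Sum>s\<in>S. \<Sum>r<p. add_char p (int r * (a + b - s)))"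
    by (subst sum.swap, intro sum.cong refl, subst sum.swap, intro sum.cong refl, subst sum.swap) simp
  also have "\<dots> = (\<Sum>a\<in>A. \<Sum>b\<in>B. of_nat p)"
  proof (intro sum.cong refl)
    fix a b assume ab: "a \<in> A" "b \<in> B"
    have "int p dvd a + b - s \<longleftrightarrow> s = (a + b) mod int p" if "s \<in> S" for s
      using that S(1) by (metis atLeastLessThan_iff mod_eq_dvd_iff mod_pos_pos_trivial subsetD)
    then have "(\<Sum>s\<in>S. \<Sum>r<p. add_char p (int r * (a + b - s)))
        = (\<Sum>s\<in>S. if s = (a + b) mod int p then of_nat p else 0)"
      using sum_add_char[OF assms(2)] by (intro sum.cong) auto
    moreover have "(a + b) mod int p \<in> S" using ab by (force simp: S_def)
    ultimately show "(\<Sum>s\<in>S. \<Sum>r<p. add_char p (int r * (a + b - s))) = of_nat p"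
      using S(2) by simp
  qed
  finally show ?thesis by (simp add: mult_ac)
qed

text \<open>In the character count of solutions the term \<open>r = 0\<close> is
  \<open>card A * card B * card S\<close>. The others are bounded by \<open>M\<close> times a sum to
  which Cauchy-Schwarz and Parseval apply.\<close>

lemma sumset_le_max_char_sum:
  fixes A B :: "int set" and p :: nat and M :: real
  defines "S \<equiv> (\<lambda>(a, b). (a + b) mod int p) ` (A \<times> B)"
  assumes p: "p > 0" and AB: "A \<subseteq> {0..<int p}" "B \<subseteq> {0..<int p}"
    and M: "\<And>r. 0 < r \<Longrightarrow> r < p \<Longrightarrow> norm (char_sum p A r) \<le> M" and "M \<ge> 0"
  shows "real (card A) * real (card B) * (real p - real (card S))
           \<le> M * real p * sqrt (real (card B) * real (card S))"
proof -
  have fin: "finite A" "finite B" using AB finite_subset by blast+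
  have S: "S \<subseteq> {0..<int p}" using p by (auto simp: S_def)
  let ?F = "\<lambda>r. char_sum p A r * char_sum p B r * cnj (char_sum p S r)"
  have split: "{..<p} = insert 0 {0<..<p}" using p by auto
  have "(\<Sum>r<p. ?F r) = of_nat (card A) * of_nat (card B) * of_nat (card S) + (\<Sum>r\<in>{0<..<p}. ?F r)"
    unfolding split by (subst sum.insert) (auto simp: char_sum_def)
  then have "(\<Sum>r\<in>{0<..<p}. ?F r)
      = complex_of_real (real (card A) * real (card B) * (real p - real (card S)))"
    using sumset_char_sum[OF p fin] by (simp add: S_def[symmetric] algebra_simps)
  then have "real (card A) * real (card B) * (real p - real (card S)) \<le> norm (\<Sum>r\<in>{0<..<p}. ?F r)"
    by (simp only: norm_of_real)
  also have "\<dots> \<le> (\<Sum>r\<in>{0<..<p}. M * (norm (char_sum p B r) * norm (char_sum p S r)))"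
    by (rule sum_norm_le) (use M in \<open>auto simp: norm_mult mult.assoc intro!: mult_right_mono\<close>)
  \<comment> \<open>Restoring the non-negative term \<open>r = 0\<close> gives the full sums that
    Parseval evaluates.\<close>
  also have "\<dots> \<le> (\<Sum>r<p. M * (norm (char_sum p B r) * norm (char_sum p S r)))"
    using \<open>M \<ge> 0\<close> by (intro sum_mono2) auto
  also have "\<dots> = M * (\<Sum>r<p. \<bar>norm (char_sum p B r)\<bar> * \<bar>norm (char_sum p S r)\<bar>)"
    by (simp add: sum_distrib_left)
  also have "\<dots> \<le> M * (L2_set (\<lambda>r. norm (char_sum p B r)) {..<p} * L2_set (\<lambda>r. norm (char_sum p S r)) {..<p})"
    using \<open>M \<ge> 0\<close> by (intro mult_left_mono L2_set_mult_ineq)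
  also have "\<dots> = M * real p * sqrt (real (card B) * real (card S))"
    by (simp add: L2_set_def parseval_char_sum[OF p] AB S real_sqrt_mult)
  finally show ?thesis .
qed

section \<open>The functions \<open>f\<^sub>s\<close>\<close>

text \<open>Existence is the intermediate value theorem on \<open>[2, 4]\<close>: at 4 the left side
  is at most \<open>K \<le> G 4\<close> since \<open>c \<ge> 0\<close>. Uniqueness holds because one
  side does not increase and the other strictly increases.\<close>

lemma ex1_root_decreasing_increasing:
  fixes c K :: real and G :: "real \<Rightarrow> real"
  assumes "K > 0" "0 \<le> c" "G 2 \<le> K * (1 - 2 * c)" "K \<le> G 4"
    and cont: "continuous_on {2..4} G" and mono: "\<And>x y. 2 \<le> x \<Longrightarrow> x < y \<Longrightarrow> G x < G y"
  shows "\<exists>!x. x \<ge> 2 \<and> K * (1 - c * x) = G x"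
proof (rule ex_ex1I)
  have "\<exists>x\<ge>2. x \<le> 4 \<and> G x - K * (1 - c * x) = 0"
  proof (rule IVT')
    have "K * c \<ge> 0" using assms by simp
    then show "0 \<le> G 4 - K * (1 - c * 4)" using assms(4) by (simp add: algebra_simps)
  qed (use assms in \<open>auto intro!: continuous_intros simp: algebra_simps\<close>)
  then show "\<exists>x. x \<ge> 2 \<and> K * (1 - c * x) = G x" by force
next
  fix x y assume "x \<ge> 2 \<and> K * (1 - c * x) = G x" "y \<ge> 2 \<and> K * (1 - c * y) = G y"
  moreover have False if "2 \<le> x" "x < y" "K * (1 - c * x) = G x" "K * (1 - c * y) = G y" for x y
  proof -
    have "c * x \<le> c * y" using that assms(2) by (intro mult_left_mono) auto
    then have "K * (1 - c * y) \<le> K * (1 - c * x)" using assms(1) by (intro mult_left_mono) auto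
    then show False using mono[OF that(1,2)] that by simp
  qed
  ultimately show "x = y" by (meson linorder_neqE_linordered_idom)
qed

text \<open>The function is the product of the increasing \<open>x powr (1/2)\<close> and
  \<open>x * sin (pi / x)\<close>, which does not decrease because the sine is concave on
  \<open>[0, pi]\<close> and vanishes at 0.\<close>

lemma powr_mult_sin_strict_mono:
  fixes x y :: real
  assumes "2 \<le> x" "x < y"
  shows "x powr (3/2) * sin (pi / x) < y powr (3/2) * sin (pi / y)"
proof -
  have conc: "concave_on {0..pi} sin"
    by (rule f''_le0_imp_concave[of _ _ cos "\<lambda>x. - sin x"])
      (auto intro!: derivative_eq_intros sin_ge_zero)
  \<comment> \<open>Concavity at \<open>pi / y\<close>, which is the convex combination of 0 and
    \<open>pi / x\<close> with weight \<open>x / y\<close> on the latter.\<close>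
  have "(1 - x / y) * sin 0 + (x / y) * sin (pi / x) \<le> sin ((1 - x / y) *\<^sub>R 0 + (x / y) *\<^sub>R (pi / x))"
    by (rule concave_onD[OF conc]) (use assms in \<open>auto simp: field_simps\<close>)
  then have le: "x * sin (pi / x) \<le> y * sin (pi / y)" using assms by (simp add: field_simps)
  have "sin (pi / x) > 0" using assms by (intro sin_gt_zero) (auto simp: field_simps)
  then have "x powr (1/2) * (x * sin (pi / x)) < y powr (1/2) * (x * sin (pi / x))"
    using assms by (intro mult_strict_right_mono powr_less_mono2) auto
  also have "\<dots> \<le> y powr (1/2) * (y * sin (pi / y))" using le by (intro mult_left_mono) auto
  finally have "x powr (1/2) * (x * sin (pi / x)) < y powr (1/2) * (y * sin (pi / y))" .
  moreover have "z powr (3/2) = z powr (1/2) * z" if "z > 0" for z :: real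
    using that powr_add[of z "1/2" 1] by simp
  ultimately show ?thesis using assms by (simp add: mult.assoc)
qed

lemma four_powr_three_halves: "4 powr (3/2) = (8::real)"
proof -
  have "4 powr (3/2) = (2 powr 2) powr (3/2 :: real)" by simp
  also have "\<dots> = 2 powr 3" by (simp only: powr_powr) simp
  finally show ?thesis by simp
qed

lemma dilate_f_2:
  assumes "0 \<le> c" "c \<le> dilate_c0 2"
  shows "dilate_f 2 c \<ge> 2 \<and> 3 * (1 - c * dilate_f 2 c) = dilate_f 2 c powr (3/2)"
proof -
  have "\<exists>!x. x \<ge> 2 \<and> 3 * (1 - c * x) = x powr (3/2)"
  proof (rule ex1_root_decreasing_increasing)
    show "2 powr (3/2) \<le> 3 * (1 - 2 * c)" using assms(2) by (simp add: dilate_c0_def field_simps)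
  qed (use assms in \<open>auto simp: four_powr_three_halves intro!: continuous_intros powr_less_mono2\<close>)
  from theI'[OF this] show ?thesis using assms by (simp add: dilate_f_def)
qed

lemma dilate_f_ge_3:
  assumes "s \<ge> 3" "0 \<le> c" "c \<le> dilate_c0 s"
  defines "f \<equiv> dilate_f s c"
  shows "f \<ge> 2 \<and> (real s + 1) * sin (pi / (real s + 1)) * (1 - c * f) = f powr (3/2) * sin (pi / f)"
proof -
  define K where "K = (real s + 1) * sin (pi / (real s + 1))"
  have "sin (pi / (real s + 1)) > 0" using assms by (intro sin_gt_zero) (auto simp: field_simps)
  then have K0: "K > 0" by (simp add: K_def)
  have "sin (pi / (real s + 1)) \<le> pi / (real s + 1)" by (intro sin_x_le_x) simp
  then have "K \<le> pi" by (simp add: K_def field_simps)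
  have "\<exists>!x. x \<ge> 2 \<and> K * (1 - c * x) = x powr (3/2) * sin (pi / x)"
  proof (rule ex1_root_decreasing_increasing)
    show "2 powr (3/2) * sin (pi / 2) \<le> K * (1 - 2 * c)"
    proof -
      have "c \<le> (1 - 2 powr (3/2) / K) / 2" using assms(1,3) by (simp add: dilate_c0_def K_def)
      then show ?thesis using K0 by (simp add: field_simps)
    qed
    \<comment> \<open>At \<open>x = 4\<close> the right side is
      \<open>8 * sin (pi / 4) = 4 * sqrt 2\<close>, while \<open>K \<le> pi\<close> by
      \<open>sin x \<le> x\<close>.\<close>
    have "pi < 4 * sqrt 2" using pi_less_4 by (smt (verit) real_sqrt_ge_1_iff)
    then show "K \<le> 4 powr (3/2) * sin (pi / 4)" using \<open>K \<le> pi\<close>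
      by (simp add: four_powr_three_halves sin_45)
  qed (use assms K0 in \<open>auto intro!: continuous_intros powr_mult_sin_strict_mono\<close>)
  from theI'[OF this] show ?thesis using assms(1-3) by (simp add: f_def dilate_f_def K_def)
qed

section \<open>Dilates modulo a prime\<close>

lemma elt_set_times_eq_image: "t *o U = (*) t ` U"
  by (auto simp: elt_set_times_def)

lemma mem_dilate_mod: "a \<in> A \<Longrightarrow> t * a mod int p \<in> dilate_mod p t A"
  by (auto simp add: dilate_mod_def elt_set_times_eq_image)

lemma dilate_mod_subset: "p > 0 \<Longrightarrow> dilate_mod p t A \<subseteq> {0..<int p}"
  by (auto simp: dilate_mod_def)

lemma mod_mult_prime_cancel:
  fixes m r a b :: int
  assumes "prime m" "\<not> m dvd r" "a \<in> {0..<m}" "b \<in> {0..<m}" "m dvd r * a - r * b"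
  shows "a = b"
proof -
  have "m dvd r * (a - b)" using assms by (simp add: algebra_simps)
  then have "m dvd a - b" using assms prime_dvd_mult_iff by blast
  then have "a mod m = b mod m" by (simp add: mod_eq_dvd_iff)
  then show ?thesis using assms by simp
qed

lemma card_dilate_mod:
  assumes "prime p" "\<not> int p dvd t" "A \<subseteq> {0..<int p}"
  shows "card (dilate_mod p t A) = card A"
proof -
  have "inj_on (\<lambda>a. t * a mod int p) A"
  proof (rule inj_onI)
    fix a b assume ab: "a \<in> A" "b \<in> A" "t * a mod int p = t * b mod int p"
    show "a = b"
    proof (rule mod_mult_prime_cancel)
      show "int p dvd t * a - t * b" using ab by (simp add: mod_eq_dvd_iff)
    qed (use ab assms in auto)
  qed
  then have "card ((\<lambda>a. t * a mod int p) ` A) = card A" by (rule card_image)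
  then show ?thesis by (simp add: dilate_mod_def elt_set_times_eq_image image_image)
qed

lemma residue_ring_set_add:
  "A <+>\<^bsub>residue_ring m\<^esub> B = (\<lambda>(a, b). (a + b) mod m) ` (A \<times> B)"
  by (auto simp: set_add_def' residue_ring_def)

text \<open>The map \<open>k\<close> lifts \<open>r * B\<close> to integers so close together that
  two elements of the integer sumset differ by less than \<open>p\<close>. Reduction modulo
  \<open>p\<close> is then injective there, and its image lies in the dilate of \<open>S\<close> by
  \<open>r\<close>.\<close>

lemma card_dilate_sum_mod_ge:
  fixes p :: nat and A B :: "int set" and k :: "int \<Rightarrow> int" and t r :: int
  defines "S \<equiv> (\<lambda>(a, b). (a + b) mod int p) ` (A \<times> dilate_mod p t A)"
  assumes p: "prime p" and A: "A \<subseteq> {0..<int p}" and r: "\<not> int p dvd r"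
    and B: "B \<subseteq> A" and k: "\<And>b. b \<in> B \<Longrightarrow> k b mod int p = r * b mod int p"
    and near: "\<And>a b. a \<in> B \<Longrightarrow> b \<in> B \<Longrightarrow> \<bar>k a - k b\<bar> * (\<bar>t\<bar> + 1) < int p"
  shows "card (k ` B + t *o k ` B) \<le> card S" and "card (k ` B) = card B"
proof -
  have p0: "int p > 0" using p prime_gt_0_nat by simp
  have finS: "finite S"
    using A p0 finite_subset[of _ "{0..<int p}"] by (force simp: S_def dilate_mod_def elt_set_times_eq_image)
  have "inj_on (\<lambda>x. x mod int p) (k ` B + t *o k ` B)"
  proof (rule inj_onI)
    fix x y
    assume "x \<in> k ` B + t *o k ` B" "y \<in> k ` B + t *o k ` B"
    then obtain a b c d where B4: "a \<in> B" "b \<in> B" "c \<in> B" "d \<in> B"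
      and x: "x = k a + t * k b" and y: "y = k c + t * k d"
      by (auto simp: set_plus_def elt_set_times_eq_image)
    assume "x mod int p = y mod int p"
    then have dvd: "int p dvd x - y" by (simp add: mod_eq_dvd_iff)
    have "x - y = (k a - k c) + t * (k b - k d)" by (simp add: x y algebra_simps)
    then have "\<bar>x - y\<bar> \<le> \<bar>k a - k c\<bar> + \<bar>t\<bar> * \<bar>k b - k d\<bar>" by (metis abs_mult abs_triangle_ineq)
    \<comment> \<open>Multiplying by \<open>\<bar>t\<bar> + 1\<close> keeps the comparison with
      \<open>p / (\<bar>t\<bar> + 1)\<close> inside the integers.\<close>
    then have "\<bar>x - y\<bar> * (\<bar>t\<bar> + 1) \<le> (\<bar>k a - k c\<bar> + \<bar>t\<bar> * \<bar>k b - k d\<bar>) * (\<bar>t\<bar> + 1)"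
      by (intro mult_right_mono) auto
    also have "\<dots> = \<bar>k a - k c\<bar> * (\<bar>t\<bar> + 1) + \<bar>t\<bar> * (\<bar>k b - k d\<bar> * (\<bar>t\<bar> + 1))"
      by (simp add: algebra_simps)
    also have "\<dots> < int p + \<bar>t\<bar> * int p"
    proof (rule add_less_le_mono)
      show "\<bar>t\<bar> * (\<bar>k b - k d\<bar> * (\<bar>t\<bar> + 1)) \<le> \<bar>t\<bar> * int p"
        by (rule mult_left_mono[OF less_imp_le[OF near]]) (use B4 in auto)
    qed (use near B4 in blast)
    also have "\<dots> = int p * (\<bar>t\<bar> + 1)" by (simp add: algebra_simps)
    finally have "\<bar>x - y\<bar> < int p" by (simp add: mult_less_cancel_right)
    then show "x = y" using dvd p0 by (metis dvd_imp_le_int leD abs_of_nonneg eq_iff_diff_eq_0 less_imp_le)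
  qed
  then have "card (k ` B + t *o k ` B) = card ((\<lambda>x. x mod int p) ` (k ` B + t *o k ` B))"
    by (rule card_image[symmetric])
  also have "\<dots> \<le> card ((\<lambda>x. r * x mod int p) ` S)"
  proof (intro card_mono finite_imageI finS subsetI)
    fix z assume "z \<in> (\<lambda>x. x mod int p) ` (k ` B + t *o k ` B)"
    then obtain a b where ab: "a \<in> B" "b \<in> B" and z: "z = (k a + t * k b) mod int p"
      by (auto simp: set_plus_def elt_set_times_eq_image)
    have "z = (r * a + t * (r * b)) mod int p"
      unfolding z by (intro mod_add_cong mod_mult_cong k ab refl)
    also have "\<dots> = r * (a + t * b) mod int p" by (simp add: algebra_simps)
    also have "\<dots> = r * ((a + t * b mod int p) mod int p) mod int p"
      by (simp add: mod_simps)
    finally have "z = r * ((a + t * b mod int p) mod int p) mod int p" .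
    moreover have "(a + t * b mod int p) mod int p \<in> S"
      unfolding S_def by (rule image_eqI[of _ _ "(a, t * b mod int p)"]) (use ab B mem_dilate_mod in auto)
    ultimately show "z \<in> (\<lambda>x. r * x mod int p) ` S" by blast
  qed
  also have "\<dots> \<le> card S" by (rule card_image_le[OF finS])
  finally show "card (k ` B + t *o k ` B) \<le> card S" .
  have "inj_on k B"
  proof (rule inj_onI)
    fix a b assume ab: "a \<in> B" "b \<in> B" "k a = k b"
    show "a = b"
    proof (rule mod_mult_prime_cancel)
      have "r * a mod int p = r * b mod int p" using k[of a] k[of b] ab by metis
      then show "int p dvd r * a - r * b" by (simp add: mod_eq_dvd_iff)
    qed (use ab p r A B in auto)
  qed
  then show "card (k ` B) = card B" by (rule card_image)
qed

text \<open>Up to the rotation, the angle of \<open>a\<close> is \<open>2 * pi / p\<close> times the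
  integer \<open>r * a + p * m a\<close>. Points on one open arc thus have representatives less than
  \<open>p / (\<bar>t\<bar> + 1)\<close> apart, and the integer bound can be applied to these. An
  empty arc is covered by \<open>0 \<le> w\<close>.\<close>

lemma arc_count_le:
  fixes p :: nat and A :: "int set" and m :: "int \<Rightarrow> int" and \<psi> \<alpha> w :: real and t :: int and r :: nat
  defines "S \<equiv> (\<lambda>(a, b). (a + b) mod int p) ` (A \<times> dilate_mod p t A)"
  assumes p: "prime p" and A: "A \<subseteq> {0..<int p}" and r: "0 < r" "r < p"
    and w: "0 \<le> w" "\<And>B :: int set. finite B \<Longrightarrow> B \<noteq> {} \<Longrightarrow>
           real (card (B + t *o B)) \<ge> (\<bar>real_of_int t\<bar> + 1) * real (card B) - w"
  shows "(\<bar>real_of_int t\<bar> + 1) * real (card {a \<in> A.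
      \<bar>2 * pi * real_of_int (int r * a) / real p - \<psi> + 2 * pi * m a - \<alpha>\<bar> < pi / (\<bar>real_of_int t\<bar> + 1)})
    \<le> real (card S) + w"
proof -
  define B where "B = {a \<in> A. \<bar>2 * pi * real_of_int (int r * a) / real p - \<psi> + 2 * pi * m a - \<alpha>\<bar> < pi / (\<bar>real_of_int t\<bar> + 1)}"
  have p0: "real p > 0" using r by simp
  define k where "k = (\<lambda>a. int r * a + int p * m a)"
  have pr: "\<not> int p dvd int r" using r by (simp add: nat_dvd_not_less)
  have k: "k b mod int p = int r * b mod int p" for b by (simp add: k_def)
  have near: "\<bar>k a - k b\<bar> * (\<bar>t\<bar> + 1) < int p" if "a \<in> B" "b \<in> B" for a b
  proof -
    have eq: "2 * pi * real_of_int (int r * a) / real p - \<psi> + 2 * pi * m a = 2 * pi / p * k a - \<psi>" for a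
      using p0 by (simp add: k_def field_simps)
    let ?h = "pi / (\<bar>real_of_int t\<bar> + 1)"
    have "\<bar>2 * pi / p * k a - \<psi> - \<alpha>\<bar> < ?h" "\<bar>2 * pi / p * k b - \<psi> - \<alpha>\<bar> < ?h"
      using that by (simp_all only: B_def eq mem_Collect_eq)
    then have "\<bar>2 * pi / p * k a - 2 * pi / p * k b\<bar> < 2 * ?h" by linarith
    also have "2 * pi / p * k a - 2 * pi / p * k b = 2 * pi / p * real_of_int (k a - k b)"
      by (simp only: of_int_diff right_diff_distrib)
    also have "\<bar>\<dots>\<bar> = 2 * pi / p * \<bar>real_of_int (k a - k b)\<bar>" by (simp add: abs_mult)
    finally have prod: "2 * pi / p * \<bar>real_of_int (k a - k b)\<bar> * (\<bar>real_of_int t\<bar> + 1) < 2 * pi"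
      by (simp add: field_simps)
    have "\<bar>real_of_int (k a - k b)\<bar> * (\<bar>real_of_int t\<bar> + 1) < p"
    proof -
      have "2 * pi / p * x < 2 * pi \<longleftrightarrow> x < p" for x :: real
        using p0 by (simp add: field_simps)
      then show ?thesis using prod by (metis mult.assoc)
    qed
    then have "real_of_int (\<bar>k a - k b\<bar> * (\<bar>t\<bar> + 1)) < real_of_int (int p)" by simp
    then show ?thesis by (simp only: of_int_less_iff)
  qed
  have "(\<bar>real_of_int t\<bar> + 1) * real (card B) \<le> real (card S) + w"
  proof (cases "B = {}")
    case True
    then show ?thesis using w(1) by simp
  next
    case False
    have sub: "B \<subseteq> A" by (auto simp: B_def)
    note * = card_dilate_sum_mod_ge[OF p A pr sub k near]
    have "finite B" using finite_subset[OF sub finite_subset[OF A]] by simp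
    then have "(\<bar>real_of_int t\<bar> + 1) * real (card (k ` B)) - w \<le> real (card (k ` B + t *o k ` B))"
      using False by (intro w(2)) auto
    also have "\<dots> \<le> real (card S)" using *(1) unfolding S_def by simp
    finally show ?thesis using *(2) by simp
  qed
  then show ?thesis unfolding B_def .
qed

section \<open>The lower bound for \<open>A + t A\<close> from arc counts and character sums\<close>

theorem theorem1:
  fixes p :: nat and A :: "int set" and t :: int and w :: "int \<Rightarrow> real"
  assumes "prime p"
    and "A \<subseteq> carrier (residue_ring (int p))" and "A \<noteq> {}"
    and "t \<notin> {0, 1, -1}"
    and "primepow \<bar>t\<bar> \<or> (\<exists>q r. prime q \<and> prime r \<and> \<bar>t\<bar> = q * r)"
    and "\<And>B :: int set. finite B \<Longrightarrow> B \<noteq> {} \<Longrightarrow>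
           real (card (B + t *o B)) \<ge> (\<bar>real_of_int t\<bar> + 1) * real (card B) - w t"
  shows "real (card (A <+>\<^bsub>residue_ring (int p)\<^esub> dilate_mod p t A))
           \<ge> min (dilate_f (nat \<bar>t\<bar>) (real (card A) / real p) * real (card A) - w t) (real p)"
proof -
  define S where "S = (\<lambda>(a, b). (a + b) mod int p) ` (A \<times> dilate_mod p t A)"
  define N where "N = real (card A)"
  define s where "s = nat \<bar>t\<bar>"
  define f where "f = dilate_f s (N / p)"
  have p0: "real p > 0" "p > 0" "int p > 0" using prime_gt_0_nat[OF assms(1)] by simp_all
  have ip: "prime (int p)" using assms(1) by simp
  have A: "A \<subseteq> {0..<int p}" using assms(2) by (auto simp: residue_ring_def)
  have finA: "finite A" using A finite_subset by blast
  have N0: "N > 0" using finA assms(3) by (simp add: N_def card_gt_0_iff)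
  have Np: "N \<le> p" using card_mono[OF _ A] by (simp add: N_def)
  have s: "s \<ge> 2" "\<bar>real_of_int t\<bar> = real s" using assms(4) by (auto simp: s_def)
  have "(\<bar>real_of_int t\<bar> + 1) * real (card {0::int}) - w t \<le> real (card ({0} + t *o {0::int}))"
    by (intro assms(6)) auto
  then have w: "w t \<ge> s" using s by (simp add: elt_set_times_eq_image set_plus_def)
  have "min (f * N - w t) p \<le> real (card S)"
  proof (cases "N / p > dilate_c0 s")
    case True
    then have f2: "f = 2" by (simp add: f_def dilate_f_def)
    show ?thesis
    proof (cases "int p dvd t")
      case True
      \<comment> \<open>Here the dilate is \<open>{0}\<close>, so \<open>S\<close> has
        \<open>N\<close> elements, and \<open>2 * N - w t \<le> N\<close> follows from
        \<open>w t \<ge> s \<ge> p \<ge> N\<close>.\<close>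
      then have "p \<le> s" using assms(4) dvd_imp_le_int[OF _ True] by (simp add: s_def)
      moreover have "dilate_mod p t A = {0}"
        using True assms(3) by (auto simp: dilate_mod_def elt_set_times_eq_image image_iff)
      then have "A \<times> dilate_mod p t A = (\<lambda>a. (a, 0)) ` A" by auto
      then have "S = (\<lambda>a. a mod int p) ` A" by (simp add: S_def image_image)
      moreover have "(\<lambda>a. a mod int p) ` A = (\<lambda>a. a) ` A" using A by (intro image_cong) auto
      ultimately show ?thesis using f2 w Np by (simp add: N_def)
    next
      case False
      have "dilate_mod p t A \<noteq> {}" using assms(3) mem_dilate_mod by blast
      note cauchy_davenport_mod[OF ip A dilate_mod_subset[OF p0(2)] assms(3) this]
      then have "min (int p) (2 * int (card A) - 1) \<le> int (card S)"
        unfolding S_def card_dilate_mod[OF assms(1) False A] by linarith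
      \<comment> \<open>The 1 lost in Cauchy-Davenport is absorbed by
        \<open>w t \<ge> s \<ge> 2\<close>.\<close>
      then have "p \<le> card S \<or> 2 * card A \<le> card S + 1" by linarith
      then have "real p \<le> real (card S) \<or> 2 * N \<le> real (card S) + 1" unfolding N_def by linarith
      then show ?thesis using f2 w s by (simp only: min_le_iff_disj) linarith
    qed
  next
    case False
    then have c: "0 \<le> N / p" "N / p \<le> dilate_c0 s" using N0 by auto
    \<comment> \<open>With \<open>K\<close> and \<open>D\<close> both defining equations of
      \<open>f\<close> read \<open>K * (1 - c * f) = f powr (3/2) * D\<close>, and both Fourier
      bounds become \<open>f * N * D / K\<close>.\<close>
    define K where "K = (if s = 2 then 3 else (real s + 1) * sin (pi / (real s + 1)))"
    define D where "D = (if s = 2 then 1 else sin (pi / f))"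
    have "f \<ge> 2 \<and> K * (1 - N / p * f) = f powr (3/2) * D"
    proof (cases "s = 2")
      case True
      then show ?thesis using dilate_f_2[of "N / p"] c by (simp add: f_def K_def D_def)
    next
      case False
      then show ?thesis using dilate_f_ge_3[of s "N / p"] c s(1) by (simp add: f_def K_def D_def)
    qed
    then have f: "f \<ge> 2" and eq: "K * (1 - N / p * f) = f powr (3/2) * D" by auto
    have "sin (pi / (real s + 1)) > 0" using s by (intro sin_gt_zero) (auto simp: field_simps)
    then have K0: "K > 0" by (simp add: K_def)
    have "sin (pi / f) \<ge> 0" using f by (intro sin_ge_zero) (auto simp: field_simps)
    then have D0: "D \<ge> 0" by (simp add: D_def)
    \<comment> \<open>The defining equation of \<open>f\<close>, scaled by \<open>p / K\<close>. It
      shows \<open>f * N \<le> p\<close> and closes the final chain of inequalities.\<close>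
    have fp: "p - f * N = p * f powr (3/2) * D / K"
    proof -
      have "p * f powr (3/2) * D / K = p * (f powr (3/2) * D) / K" by simp
      also have "\<dots> = p - f * N" unfolding eq[symmetric] using K0 p0 by (simp add: field_simps)
      finally show ?thesis by simp
    qed
    moreover have "p * f powr (3/2) * D / K \<ge> 0" using D0 K0 by simp
    ultimately have fNp: "f * N \<le> p" by linarith
    show ?thesis
    proof (cases "int p dvd t")
      case True
      \<comment> \<open>Now \<open>f * N \<le> p \<le> s \<le> w t\<close>, so the claimed lower
        bound is not positive.\<close>
      then have "p \<le> s" using assms(4) dvd_imp_le_int[OF _ True] by (simp add: s_def)
      then show ?thesis using fNp w by simp
    next
      case False
      have "f * N - w t \<le> card S"
      proof (rule ccontr)
        assume "\<not> f * N - w t \<le> card S"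
        then have less: "card S + w t < f * N" by simp
        \<comment> \<open>An arc of length \<open>2 * pi / (s + 1)\<close> with more than
          \<open>n\<close> points would give \<open>card S + w t > f * N\<close>, against
          \<open>less\<close>.\<close>
        define n where "n = f * N / (s + 1)"
        define M where "M = f * N * D / K"
        have M: "norm (char_sum p A r) \<le> M" if r: "0 < r" "r < p" for r
        proof -
          obtain \<psi> and m :: "int \<Rightarrow> int"
            where sum: "norm (\<Sum>a\<in>A. cis (2 * pi * real_of_int (int r * a) / real p))
                = (\<Sum>a\<in>A. cos (2 * pi * real_of_int (int r * a) / real p - \<psi> + 2 * pi * m a))"
              and bound: "\<And>a. \<bar>2 * pi * real_of_int (int r * a) / real p - \<psi> + 2 * pi * m a\<bar> \<le> pi"
            using norm_sum_cis_eq_sum_cos[of "\<lambda>a. 2 * pi * real_of_int (int r * a) / real p" A] by (elim exE conjE) (rule that, assumption, erule spec)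
          define \<theta> where "\<theta> = (\<lambda>a. 2 * pi * real_of_int (int r * a) / real p - \<psi> + 2 * pi * m a)"
          have count: "real (card {a \<in> A. \<bar>\<theta> a - \<alpha>\<bar> < pi / (real s + 1)}) \<le> n" for \<alpha>
          proof -
            have "(real s + 1) * real (card {a \<in> A. \<bar>\<theta> a - \<alpha>\<bar> < pi / (real s + 1)}) \<le> real (card S) + w t"
              unfolding \<theta>_def S_def s(2)[symmetric]
              by (rule arc_count_le[OF assms(1) A r _ assms(6)]) (use w in auto)
            then show ?thesis using less by (simp add: n_def field_simps)
          qed
          have "norm (char_sum p A r) = (\<Sum>a\<in>A. cos (\<theta> a))"
            using sum by (simp add: char_sum_def add_char_def \<theta>_def)
          also have "\<dots> \<le> M"
          proof (cases "s = 2")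
            case True
            then show ?thesis
              using sum_cos_le_count[of A \<theta> n] finA bound count
              by (simp add: M_def n_def K_def D_def \<theta>_def)
          next
            case False
            \<comment> \<open>With \<open>h = pi / (s + 1)\<close> the balance
              \<open>n * b = N * h\<close> forces \<open>b = pi / f\<close>, and
              \<open>f \<ge> 2\<close> ensures \<open>b \<le> pi / 2\<close>.\<close>
            have "(\<Sum>a\<in>A. cos (\<theta> a)) \<le> n * sin (pi / f) / sin (pi / (real s + 1))"
            proof (rule sum_cos_le_sin[OF finA _ _ _ _ _ count])
              show "n * (pi / f) = real (card A) * (pi / (real s + 1))"
                using f by (simp add: n_def N_def)
              show "pi / (real s + 1) \<le> pi / 2" "pi / f \<le> pi / 2"
                by (rule divide_left_mono; use f s in simp)+
            qed (use bound f s in \<open>auto simp: \<theta>_def\<close>)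
            also have "\<dots> = M" using False by (simp add: n_def M_def K_def D_def)
            finally show ?thesis .
          qed
          finally show ?thesis .
        qed
        \<comment> \<open>The assumption \<open>card S < f * N\<close> enters twice, in
          \<open>p - card S\<close> and under the square root. By the defining equation of
          \<open>f\<close> the two ends of the chain coincide, which contradicts the strict first
          step.\<close>
        have "N * N * (p - f * N) < N * N * (real p - real (card S))"
          using less w N0 by (intro mult_strict_left_mono) auto
        also have "\<dots> \<le> M * p * sqrt (N * card S)"
          using sumset_le_max_char_sum[OF p0(2) A dilate_mod_subset[OF p0(2)] M, of t A]
            card_dilate_mod[OF assms(1) False A] D0 K0 N0 f by (simp add: S_def N_def M_def)
        also have "\<dots> \<le> M * p * sqrt (N * (f * N))"
          using less w N0 D0 K0 f
          by (intro mult_left_mono real_sqrt_le_mono) (auto simp: M_def)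
        also have "sqrt (N * (f * N)) = N * f powr (1/2)"
          using N0 f by (simp add: powr_half_sqrt real_sqrt_mult)
        also have "M * p * (N * f powr (1/2)) = N * N * (p * (f * f powr (1/2)) * D / K)"
          by (simp add: M_def)
        also have "f * f powr (1/2) = f powr (3/2)"
          using f powr_add[of f 1 "1/2"] by simp
        also have "p * f powr (3/2) * D / K = p - f * N" by (rule fp[symmetric])
        finally show False by simp
      qed
      then show ?thesis by simp
    qed
  qed
  then show ?thesis by (simp add: residue_ring_set_add S_def f_def s_def N_def)
qed

end
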